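(* There exists a co-Stone residuated lattice $A$ and an element $a\in A$ such that $\neg a\vee\neg\neg a\neq 1$.
   Context: A residuated lattice is an algebra $(A,\vee,\wedge,\odot,\rightarrow,0,1)$ such that $(A,\vee,\wedge,0,1)$ is a bounded lattice, $(A,\odot,1)$ is a commutative monoid, and $a\leq b\rightarrow c$ iff $a\odot b\leq c$ for all $a,b,c\in A$. $\neg a=a\rightarrow 0$. A filter of $A$ is a non-empty upward closed subset closed under $\odot$; $\langle x\rangle$ is the filter generated by $x$. $B(A)$ is the set of complemented elements of the bounded lattice $A$, and $x^{\top}=\{a\in A\mid a\vee x=1\}$. $A$ is co-Stone iff for all $x\in A$ there exists $e\in B(A)$ with $x^{\top}=\langle e\rangle$. *)

theory Defs
  imports "HOL-Algebra.Group"
begin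

(* The signature (carrier, mult, one) of HOL-Algebra monoids provides the underlying set, the
   product and 1; since 1 is both the monoid unit and the top element, it is shared. *)
record 'a reslat = "'a monoid" +
  rl_join :: "'a \<Rightarrow> 'a \<Rightarrow> 'a" (infixl "\<curlyvee>\<index>" 65)
  rl_meet :: "'a \<Rightarrow> 'a \<Rightarrow> 'a" (infixl "\<curlywedge>\<index>" 70)
  rl_imp :: "'a \<Rightarrow> 'a \<Rightarrow> 'a" (infixr "\<leadsto>\<index>" 60)
  rl_zero :: 'a ("\<zero>\<index>")

definition rl_le :: "('a, 'm) reslat_scheme \<Rightarrow> 'a \<Rightarrow> 'a \<Rightarrow> bool" (infix "\<preceq>\<index>" 50)
  where "x \<preceq>\<^bsub>A\<^esub> y \<longleftrightarrow> x \<curlywedge>\<^bsub>A\<^esub> y = x"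

definition rl_neg :: "('a, 'm) reslat_scheme \<Rightarrow> 'a \<Rightarrow> 'a" ("rneg\<index> _" [81] 80)
  where "rneg\<^bsub>A\<^esub> x = x \<leadsto>\<^bsub>A\<^esub> \<zero>\<^bsub>A\<^esub>"

locale residuated_lattice = comm_monoid A for A (structure) +
  assumes join_closed: "\<lbrakk>x \<in> carrier A; y \<in> carrier A\<rbrakk> \<Longrightarrow> x \<curlyvee> y \<in> carrier A"
    and meet_closed: "\<lbrakk>x \<in> carrier A; y \<in> carrier A\<rbrakk> \<Longrightarrow> x \<curlywedge> y \<in> carrier A"
    and imp_closed: "\<lbrakk>x \<in> carrier A; y \<in> carrier A\<rbrakk> \<Longrightarrow> x \<leadsto> y \<in> carrier A"
    and zero_closed: "\<zero> \<in> carrier A"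
    and join_assoc: "\<lbrakk>x \<in> carrier A; y \<in> carrier A; z \<in> carrier A\<rbrakk>
                       \<Longrightarrow> (x \<curlyvee> y) \<curlyvee> z = x \<curlyvee> (y \<curlyvee> z)"
    and meet_assoc: "\<lbrakk>x \<in> carrier A; y \<in> carrier A; z \<in> carrier A\<rbrakk>
                       \<Longrightarrow> (x \<curlywedge> y) \<curlywedge> z = x \<curlywedge> (y \<curlywedge> z)"
    and join_comm: "\<lbrakk>x \<in> carrier A; y \<in> carrier A\<rbrakk> \<Longrightarrow> x \<curlyvee> y = y \<curlyvee> x"
    and meet_comm: "\<lbrakk>x \<in> carrier A; y \<in> carrier A\<rbrakk> \<Longrightarrow> x \<curlywedge> y = y \<curlywedge> x"
    and join_absorb: "\<lbrakk>x \<in> carrier A; y \<in> carrier A\<rbrakk> \<Longrightarrow> x \<curlyvee> (x \<curlywedge> y) = x"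
    and meet_absorb: "\<lbrakk>x \<in> carrier A; y \<in> carrier A\<rbrakk> \<Longrightarrow> x \<curlywedge> (x \<curlyvee> y) = x"
    and zero_least: "x \<in> carrier A \<Longrightarrow> \<zero> \<preceq> x"
    and one_greatest: "x \<in> carrier A \<Longrightarrow> x \<preceq> \<one>"
    and residuation: "\<lbrakk>a \<in> carrier A; b \<in> carrier A; c \<in> carrier A\<rbrakk>
                       \<Longrightarrow> a \<preceq> b \<leadsto> c \<longleftrightarrow> a \<otimes> b \<preceq> c"

definition rl_filter :: "('a, 'm) reslat_scheme \<Rightarrow> 'a set \<Rightarrow> bool"
  where "rl_filter A F \<longleftrightarrow> F \<subseteq> carrier A \<and> F \<noteq> {} \<and>
    (\<forall>x\<in>F. \<forall>y\<in>carrier A. x \<preceq>\<^bsub>A\<^esub> y \<longrightarrow> y \<in> F) \<and>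
    (\<forall>x\<in>F. \<forall>y\<in>F. x \<otimes>\<^bsub>A\<^esub> y \<in> F)"

definition generated_filter :: "('a, 'm) reslat_scheme \<Rightarrow> 'a \<Rightarrow> 'a set"
  where "generated_filter A x = \<Inter>{F. rl_filter A F \<and> x \<in> F}"

definition complemented_elements :: "('a, 'm) reslat_scheme \<Rightarrow> 'a set"
  where "complemented_elements A =
    {e \<in> carrier A. \<exists>f\<in>carrier A. e \<curlyvee>\<^bsub>A\<^esub> f = \<one>\<^bsub>A\<^esub> \<and> e \<curlywedge>\<^bsub>A\<^esub> f = \<zero>\<^bsub>A\<^esub>}"

definition coannihilator :: "('a, 'm) reslat_scheme \<Rightarrow> 'a \<Rightarrow> 'a set"
  where "coannihilator A x = {a \<in> carrier A. a \<curlyvee>\<^bsub>A\<^esub> x = \<one>\<^bsub>A\<^esub>}"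

locale co_stone_residuated_lattice = residuated_lattice +
  assumes co_stone:
    "x \<in> carrier A \<Longrightarrow> \<exists>e\<in>complemented_elements A. coannihilator A x = generated_filter A e"

end

(* A residuated lattice in which 1 is join-irreducible, in particular any chain, is co-Stone: the
   coannihilator of 1 is the whole algebra, generated by 0, and every other coannihilator is {1}.
   In the three-element Lukasiewicz chain the middle element m satisfies rneg m = m, so
   rneg m \<or> rneg (rneg m) = m is not 1. *)
theory Submission
  imports Defs
begin

context residuated_lattice
begin

text \<open>Absorbing twice gives idempotence of the meet: \<open>x \<curlywedge> x = x
  \<curlywedge> (x \<curlyvee> (x \<curlywedge> x)) = x\<close>.\<close>

lemma le_refl: "x \<in> carrier A \<Longrightarrow> x \<preceq> x"
  unfolding rl_le_def by (metis join_absorb meet_absorb meet_closed)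

lemma one_le_iff: "x \<in> carrier A \<Longrightarrow> \<one> \<preceq> x \<longleftrightarrow> x = \<one>"
  using one_greatest le_refl unfolding rl_le_def by (metis meet_comm one_closed)

lemma join_one: "x \<in> carrier A \<Longrightarrow> x \<curlyvee> \<one> = \<one>"
  by (metis join_absorb join_comm meet_comm one_closed one_greatest rl_le_def)

lemma one_complemented: "\<one> \<in> complemented_elements A"
  unfolding complemented_elements_def
  using join_one join_comm meet_comm zero_closed one_greatest[OF zero_closed]
  by (auto simp: rl_le_def intro!: bexI[of _ "\<zero>"])

lemma zero_complemented: "\<zero> \<in> complemented_elements A"
  unfolding complemented_elements_def
  using join_one zero_closed one_greatest[OF zero_closed]
  by (auto simp: rl_le_def intro!: bexI[of _ "\<one>"])

lemma generated_filter_one: "generated_filter A \<one> = {\<one>}"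
proof -
  \<comment> \<open>Upward closure holds since nothing but 1 lies above 1.\<close>
  have "rl_filter A {\<one>}"
    by (auto simp: rl_filter_def one_le_iff)
  then show ?thesis
    unfolding generated_filter_def by auto
qed

lemma generated_filter_zero: "generated_filter A \<zero> = carrier A"
proof -
  have "rl_filter A (carrier A)"
    using zero_closed by (auto simp: rl_filter_def)
  moreover have "carrier A \<subseteq> F" if "rl_filter A F" "\<zero> \<in> F" for F
    using that zero_least by (auto simp: rl_filter_def)
  ultimately show ?thesis
    unfolding generated_filter_def using zero_closed by blast
qed

lemma co_stone_if_one_join_irreducible:
  assumes irreducible: "\<And>x y. \<lbrakk>x \<in> carrier A; y \<in> carrier A; x \<curlyvee> y = \<one>\<rbrakk> \<Longrightarrow> x = \<one> \<or> y = \<one>"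
  shows "co_stone_residuated_lattice A"
proof
  fix x
  assume x: "x \<in> carrier A"
  show "\<exists>e\<in>complemented_elements A. coannihilator A x = generated_filter A e"
  proof (cases "x = \<one>")
    case True
    then have "coannihilator A x = generated_filter A \<zero>"
      by (auto simp: coannihilator_def generated_filter_zero join_one)
    then show ?thesis
      using zero_complemented by blast
  next
    case False
    then have "coannihilator A x = generated_filter A \<one>"
      using irreducible[OF _ x] x join_one[OF x] join_comm[OF x one_closed]
      by (auto simp: coannihilator_def generated_filter_one)
    then show ?thesis
      using one_complemented by blast
  qed
qed

end

text \<open>The value \<open>i / n\<close> of the Lukasiewicz chain is encoded by \<open>i\<close>; truncated subtraction on
  \<open>nat\<close> supplies the \<open>max 0\<close> in the product \<open>max 0 (x + y - 1)\<close> and the \<open>min 1\<close> in the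
  implication \<open>min 1 (1 - x + y)\<close>.\<close>

definition lukasiewicz_chain :: "nat \<Rightarrow> nat reslat"
  where "lukasiewicz_chain n =
    \<lparr>carrier = {..n}, mult = (\<lambda>x y. x + y - n), one = n,
     rl_join = max, rl_meet = min, rl_imp = (\<lambda>x y. n - (x - y)), rl_zero = 0\<rparr>"

text \<open>Both sides of residuation amount to \<open>a + b \<le> n + c\<close>. Both bracketings
  of a triple product equal \<open>x + y + z - 2 * n\<close>, as no element exceeds
  \<open>n\<close>.\<close>

lemma residuated_lattice_lukasiewicz_chain: "residuated_lattice (lukasiewicz_chain n)"
  by unfold_locales (auto simp: lukasiewicz_chain_def rl_le_def min_def max_def Units_def)

lemma co_stone_lukasiewicz_chain: "co_stone_residuated_lattice (lukasiewicz_chain n)"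
proof -
  interpret residuated_lattice "lukasiewicz_chain n"
    by (rule residuated_lattice_lukasiewicz_chain)
  show ?thesis
    \<comment> \<open>The maximum of two elements is one of them, so 1 is join-irreducible.\<close>
    by (rule co_stone_if_one_join_irreducible)
      (auto simp: lukasiewicz_chain_def max_def split: if_splits)
qed

theorem mainTheorem5:
  "\<exists>A :: nat reslat. co_stone_residuated_lattice A \<and>
     (\<exists>a\<in>carrier A. rneg\<^bsub>A\<^esub> a \<curlyvee>\<^bsub>A\<^esub> rneg\<^bsub>A\<^esub> (rneg\<^bsub>A\<^esub> a) \<noteq> \<one>\<^bsub>A\<^esub>)"
proof (intro exI conjI bexI)
  show "co_stone_residuated_lattice (lukasiewicz_chain 2)"
    by (rule co_stone_lukasiewicz_chain)
  \<comment> \<open>The number \<open>1\<close> encodes the midpoint 1/2, fixed by negation as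
    \<open>2 - (1 - 0) = 1\<close>; the top element is \<open>2\<close>.\<close>
  show "1 \<in> carrier (lukasiewicz_chain 2)"
    by (simp add: lukasiewicz_chain_def)
  let ?A = "lukasiewicz_chain 2"
  show "rneg\<^bsub>?A\<^esub> 1 \<curlyvee>\<^bsub>?A\<^esub> rneg\<^bsub>?A\<^esub> (rneg\<^bsub>?A\<^esub> 1) \<noteq> \<one>\<^bsub>?A\<^esub>"
    by (simp add: lukasiewicz_chain_def rl_neg_def)
qed

end
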